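(* Let $(P_\theta^{(n)}:\theta\in\Theta)$, $n\in\mathbb{N}$, be a sequence of statistical experiments indexed by a metric space $(\Theta,d)$, and let $\Theta_1\subset\Theta$. Let $0<\alpha<\beta<1$ and let $\varepsilon_n$ be a sequence of positive numbers such that for every estimator sequence $T_n$ $$\liminf_{n\to\infty}\sup_{\theta\in\Theta_1}P_\theta^{(n)}\bigl(d(T_n,\theta)\ge\varepsilon_n\bigr)>\beta .$$ Then for any sequence of confidence sets $\hat C_n\subset\Theta$ satisfying $$\liminf_{n\to\infty}\inf_{\theta\in\Theta}P_\theta^{(n)}(\theta\in\hat C_n)\ge1-\alpha,$$ one has $$\liminf_{n\to\infty}\sup_{\theta\in\Theta_1}P_\theta^{(n)}\bigl(\operatorname{diam}(\hat C_n)\ge\varepsilon_n\bigr)>\beta-\alpha .$$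
   Context: An estimator $T_n$ is a $\Theta$-valued function of the observation of the $n$th experiment. A confidence set $\hat C_n$ is a random subset of $\Theta$ depending on the observation of the $n$th experiment; $\operatorname{diam}$ is the diameter with respect to $d$ (zero for the empty set). Appropriate measurability assumptions regarding the confidence regions are understood, including that an estimator $T_n$ can be chosen with $T_n\in\hat C_n$ whenever $\hat C_n\neq\emptyset$ and that all events occurring are measurable. *)

theory Defs
  imports "HOL-Probability.Probability"
begin

text \<open>The measure \<open>X\<close> is used only for its space and sigma-algebra (the sample space of the
  experiment); its values are irrelevant.\<close>

definition statistical_experiment :: "'x measure \<Rightarrow> 'a set \<Rightarrow> ('a \<Rightarrow> 'x measure) \<Rightarrow> bool" where
  "statistical_experiment X \<Theta> P \<longleftrightarrow> (\<forall>\<theta>\<in>\<Theta>. prob_space (P \<theta>) \<and> sets (P \<theta>) = sets X)"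

text \<open>The events required to be measurable are those generating the ball sigma-algebra of \<open>\<Theta>\<close>; for
  separable \<open>\<Theta>\<close> this amounts to Borel measurability.\<close>

definition estimator :: "'x measure \<Rightarrow> 'a::metric_space set \<Rightarrow> ('x \<Rightarrow> 'a) \<Rightarrow> bool" where
  "estimator X \<Theta> T \<longleftrightarrow> T \<in> space X \<rightarrow> \<Theta> \<and>
     (\<forall>\<theta>\<in>\<Theta>. \<forall>r::real. {x \<in> space X. dist (T x) \<theta> \<ge> r} \<in> sets X)"

definition confidence_set :: "'x measure \<Rightarrow> 'a set \<Rightarrow> ('x \<Rightarrow> 'a set) \<Rightarrow> bool" where
  "confidence_set X \<Theta> C \<longleftrightarrow> C \<in> space X \<rightarrow> Pow \<Theta> \<and>
     (\<forall>\<theta>\<in>\<Theta>. {x \<in> space X. \<theta> \<in> C x} \<in> sets X)"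

text \<open>The real-valued \<^const>\<open>diameter\<close> of the library has no meaningful value on unbounded sets; here
  the diameter of an unbounded set is \<open>\<infinity>\<close>. The empty set needs its own case because the supremum of
  the empty set of extended reals is \<open>-\<infinity>\<close>.\<close>

definition ediameter :: "'a::metric_space set \<Rightarrow> ereal" where
  "ediameter S = (if S = {} then 0 else SUP (x, y) \<in> S \<times> S. ereal (dist x y))"

end

theory Submission
  imports Defs
begin

text \<open>
  A point chosen from a confidence set estimates the parameter with an error of at most the diameter
  whenever the set covers the parameter. Thus an error of at least \<open>\<epsilon>\<close> has only two possible causes:
  the set misses the parameter, or its diameter is at least \<open>\<epsilon>\<close>. The first has
  asymptotic probability at most \<open>\<alpha>\<close>, uniformly in the parameter, while for the selected estimator
  the error has asymptotic maximal probability above \<open>\<beta>\<close> on \<open>\<Theta>1\<close>; the second must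
  account for the difference. The inequality between probabilities is \<open>prob_error_plus_coverage_le\<close>,
  valid for each experiment separately; the passage to the limit keeps the final
  inequality strict by inserting a real number strictly between \<open>\<beta>\<close> and the lower limit for the
  estimator and giving away half of that gap to the coverage.
\<close>

lemma dist_le_ediameter:
  assumes "x \<in> S" "y \<in> S"
  shows "ereal (dist x y) \<le> ediameter S"
proof -
  have "ereal (dist x y) \<le> (SUP (u, v) \<in> S \<times> S. ereal (dist u v))"
    by (rule SUP_upper2[of "(x, y)"]) (use assms in auto)
  then show ?thesis
    using assms by (auto simp: ediameter_def)
qed

text \<open>
  This is the union bound, with the probability of missing \<open>\<theta>\<close> written as one minus the coverage.
  Moving the coverage to the left avoids subtractions, so the bound also combines directly
  with lower bounds on both of its terms.
\<close>

lemma (in prob_space) prob_error_plus_coverage_le: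
  assumes error: "{x \<in> space M. dist (T x) \<theta> \<ge> r} \<in> events"
    and coverage: "{x \<in> space M. \<theta> \<in> C x} \<in> events"
    and diameter: "{x \<in> space M. ediameter (C x) \<ge> ereal r} \<in> events"
    and selection: "\<And>x. x \<in> space M \<Longrightarrow> C x \<noteq> {} \<Longrightarrow> T x \<in> C x"
  shows "\<P>(x in M. dist (T x) \<theta> \<ge> r) + \<P>(x in M. \<theta> \<in> C x)
           \<le> \<P>(x in M. ediameter (C x) \<ge> ereal r) + 1"
proof -
  let ?E = "{x \<in> space M. dist (T x) \<theta> \<ge> r}"
  let ?V = "{x \<in> space M. \<theta> \<in> C x}"
  let ?D = "{x \<in> space M. ediameter (C x) \<ge> ereal r}"
  have "?E \<subseteq> ?D \<union> (space M - ?V)"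
  proof
    fix x assume x: "x \<in> ?E"
    show "x \<in> ?D \<union> (space M - ?V)"
    proof (cases "\<theta> \<in> C x")
      case True
      then have "ereal (dist (T x) \<theta>) \<le> ediameter (C x)"
        using x selection[of x] by (intro dist_le_ediameter) auto
      moreover have "ereal r \<le> ereal (dist (T x) \<theta>)"
        using x by simp
      ultimately show ?thesis
        using x order_trans by blast
    qed (use x in auto)
  qed
  then have "prob ?E \<le> prob (?D \<union> (space M - ?V))"
    using coverage diameter by (intro finite_measure_mono) auto
  also have "\<dots> \<le> prob ?D + prob (space M - ?V)"
    using coverage diameter by (intro measure_Un_le) auto
  also have "\<dots> = prob ?D + (1 - prob ?V)"
    using prob_compl[OF coverage] by simp
  finally show ?thesis by simp
qed

theorem lemma6p2:
  fixes \<Theta> \<Theta>1 :: "'a::metric_space set"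
    and X :: "nat \<Rightarrow> 'x measure"
    and P :: "nat \<Rightarrow> 'a \<Rightarrow> 'x measure"
    and \<alpha> \<beta> :: real
    and \<epsilon> :: "nat \<Rightarrow> real"
    and C :: "nat \<Rightarrow> 'x \<Rightarrow> 'a set"
  assumes "\<And>n. statistical_experiment (X n) \<Theta> (P n)"
    and "\<Theta>1 \<subseteq> \<Theta>"
    and "0 < \<alpha>" and "\<alpha> < \<beta>" and "\<beta> < 1"
    and "\<And>n. 0 < \<epsilon> n"
    and lower_bound: "\<And>T. (\<And>n. estimator (X n) \<Theta> (T n)) \<Longrightarrow>
      liminf (\<lambda>n. SUP \<theta>\<in>\<Theta>1. ereal (\<P>(x in P n \<theta>. dist (T n x) \<theta> \<ge> \<epsilon> n))) > ereal \<beta>"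
    and confidence: "\<And>n. confidence_set (X n) \<Theta> (C n)"
    and diam_event: "\<And>n. {x \<in> space (X n). ediameter (C n x) \<ge> ereal (\<epsilon> n)} \<in> sets (X n)"
    and selection: "\<And>n. \<exists>T. estimator (X n) \<Theta> T \<and> (\<forall>x\<in>space (X n). C n x \<noteq> {} \<longrightarrow> T x \<in> C n x)"
    and coverage: "liminf (\<lambda>n. INF \<theta>\<in>\<Theta>. ereal (\<P>(x in P n \<theta>. \<theta> \<in> C n x))) \<ge> ereal (1 - \<alpha>)"
  shows "liminf (\<lambda>n. SUP \<theta>\<in>\<Theta>1. ereal (\<P>(x in P n \<theta>. ediameter (C n x) \<ge> ereal (\<epsilon> n))))
           > ereal (\<beta> - \<alpha>)"
proof -
  obtain T where T: "\<And>n. estimator (X n) \<Theta> (T n)"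
    and T_in: "\<And>n x. x \<in> space (X n) \<Longrightarrow> C n x \<noteq> {} \<Longrightarrow> T n x \<in> C n x"
    using selection by metis
  define a where "a = (\<lambda>n \<theta>. \<P>(x in P n \<theta>. dist (T n x) \<theta> \<ge> \<epsilon> n))"
  define c where "c = (\<lambda>n \<theta>. \<P>(x in P n \<theta>. \<theta> \<in> C n x))"
  define b where "b = (\<lambda>n \<theta>. \<P>(x in P n \<theta>. ediameter (C n x) \<ge> ereal (\<epsilon> n)))"
  have bound: "a n \<theta> + c n \<theta> \<le> b n \<theta> + 1" if "\<theta> \<in> \<Theta>" for n \<theta>
  proof -
    have "prob_space (P n \<theta>)" and sets: "sets (P n \<theta>) = sets (X n)"
      using assms(1)[of n] that by (auto simp: statistical_experiment_def)
    then interpret prob_space "P n \<theta>" by simp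
    note space = sets_eq_imp_space_eq[OF sets]
    show ?thesis
      unfolding a_def b_def c_def
    proof (rule prob_error_plus_coverage_le)
      show "{x \<in> space (P n \<theta>). dist (T n x) \<theta> \<ge> \<epsilon> n} \<in> events"
        using T[of n] that by (auto simp: estimator_def sets space)
      show "{x \<in> space (P n \<theta>). \<theta> \<in> C n x} \<in> events"
        using confidence[of n] that by (auto simp: confidence_set_def sets space)
      show "{x \<in> space (P n \<theta>). ediameter (C n x) \<ge> ereal (\<epsilon> n)} \<in> events"
        using diam_event[of n] by (simp add: sets space)
    qed (use T_in space in auto)
  qed
  have "ereal \<beta> < liminf (\<lambda>n. SUP \<theta>\<in>\<Theta>1. ereal (a n \<theta>))"
    unfolding a_def by (rule lower_bound[OF T])
  then obtain \<beta>' where \<beta>': "\<beta> < \<beta>'" "ereal \<beta>' < liminf (\<lambda>n. SUP \<theta>\<in>\<Theta>1. ereal (a n \<theta>))"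
    using ereal_dense2 by force
  define \<delta> where "\<delta> = (\<beta>' - \<beta>) / 2"
  have \<delta>: "0 < \<delta>" "\<beta> < \<beta>' - \<delta>"
    using \<beta>' by (auto simp: \<delta>_def field_simps)
  have "ereal (1 - \<alpha> - \<delta>) < ereal (1 - \<alpha>)"
    using \<delta> by simp
  also have "\<dots> \<le> liminf (\<lambda>n. INF \<theta>\<in>\<Theta>. ereal (c n \<theta>))"
    unfolding c_def by (rule coverage)
  finally have ev_c: "\<forall>\<^sub>F n in sequentially. ereal (1 - \<alpha> - \<delta>) < (INF \<theta>\<in>\<Theta>. ereal (c n \<theta>))"
    by (rule less_LiminfD)
  have ev_a: "\<forall>\<^sub>F n in sequentially. ereal \<beta>' < (SUP \<theta>\<in>\<Theta>1. ereal (a n \<theta>))"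
    using \<beta>'(2) by (rule less_LiminfD)
  have "\<forall>\<^sub>F n in sequentially. ereal (\<beta>' - \<alpha> - \<delta>) \<le> (SUP \<theta>\<in>\<Theta>1. ereal (b n \<theta>))"
    using ev_a ev_c
  proof eventually_elim
    case (elim n)
    obtain \<theta> where \<theta>: "\<theta> \<in> \<Theta>1" "\<beta>' < a n \<theta>"
      using elim(1) by (auto simp: less_SUP_iff)
    then have "\<theta> \<in> \<Theta>"
      using assms(2) by blast
    then have "ereal (1 - \<alpha> - \<delta>) < ereal (c n \<theta>)"
      using elim(2) by (meson INF_lower less_le_trans)
    then have "\<beta>' - \<alpha> - \<delta> \<le> b n \<theta>"
      using bound[OF \<open>\<theta> \<in> \<Theta>\<close>, of n] \<theta>(2) by simp
    then show ?case
      using \<theta>(1) by (intro SUP_upper2[of \<theta>]) auto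
  qed
  then have "ereal (\<beta>' - \<alpha> - \<delta>) \<le> liminf (\<lambda>n. SUP \<theta>\<in>\<Theta>1. ereal (b n \<theta>))"
    by (rule Liminf_bounded)
  moreover have "ereal (\<beta> - \<alpha>) < ereal (\<beta>' - \<alpha> - \<delta>)"
    using \<delta> by simp
  ultimately show ?thesis
    unfolding b_def by (rule less_le_trans[rotated])
qed

end
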